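(* Let $\mathcal{B}$ be an orthonormal basis of $\mathbb{C}^2\otimes\mathbb{C}^2$ consisting of four product states, one of which is $|00\rangle_{AB}$. Then, up to the order of the remaining three states and up to global phases, the remaining three states are either $$|\alpha_0\rangle_A\otimes|1\rangle_B,\quad|\alpha_1\rangle_A\otimes|1\rangle_B,\quad|10\rangle_{AB}$$ for some orthonormal basis $\{|\alpha_0\rangle,|\alpha_1\rangle\}$ of $\mathbb{C}^2$, or $$|1\rangle_A\otimes|\beta_0\rangle_B,\quad|1\rangle_A\otimes|\beta_1\rangle_B,\quad|01\rangle_{AB}$$ for some orthonormal basis $\{|\beta_0\rangle,|\beta_1\rangle\}$ of $\mathbb{C}^2$.
   Context: $|0\rangle,|1\rangle$ is the standard basis of $\mathbb{C}^2$ and $|jk\rangle_{AB}=|j\rangle_A\otimes|k\rangle_B$. A state is a unit vector; a state in $\mathbb{C}^2\otimes\mathbb{C}^2$ is a product state if it equals $|u\rangle\otimes|v\rangle$ for some $|u\rangle,|v\rangle\in\mathbb{C}^2$. "Up to global phases" means each state may be multiplied by a complex number of modulus one. *)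

theory Defs
  imports "HOL-Analysis.Analysis"
begin

text \<open>
  The numeral type \<open>2\<close> has the elements \<open>0\<close> and \<open>1\<close>, and the coordinates of \<open>complex ^ 2\<close> are
  labelled by them.  The space of the composite system AB, the tensor product of two copies of
  \<open>complex ^ 2\<close>, is realised as \<open>complex ^ (2 \<times> 2)\<close>, with coordinates labelled by pairs
  (A-index, B-index).  The inherited \<^const>\<open>norm\<close> is the Hermitian norm, but the library inner
  product on these types is only the real one, hence \<open>braket\<close>.  Linear span and independence over
  the complex scalars are \<^const>\<open>vec.span\<close> and \<^const>\<open>vec.independent\<close>; the unqualified
  constants would be real-linear.
\<close>

definition braket :: "complex ^ 'n::finite \<Rightarrow> complex ^ 'n \<Rightarrow> complex"
  where "braket x y = (\<Sum>i\<in>UNIV. cnj (x $ i) * y $ i)"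

definition orthonormal_basis :: "(complex ^ 'n::finite) set \<Rightarrow> bool"
  where "orthonormal_basis B \<longleftrightarrow>
    vec.independent B \<and> vec.span B = UNIV \<and>
    (\<forall>x\<in>B. norm x = 1) \<and> pairwise (\<lambda>x y. braket x y = 0) B"

definition tensor :: "complex ^ 2 \<Rightarrow> complex ^ 2 \<Rightarrow> complex ^ (2 \<times> 2)"  (infixr "\<otimes>" 75)
  where "u \<otimes> v = (\<chi> p. u $ fst p * v $ snd p)"

definition ket :: "2 \<Rightarrow> complex ^ 2"
  where "ket j = axis j 1"

definition ket_AB :: "2 \<Rightarrow> 2 \<Rightarrow> complex ^ (2 \<times> 2)"
  where "ket_AB j k = ket j \<otimes> ket k"

definition state :: "complex ^ 'n::finite \<Rightarrow> bool"
  where "state x \<longleftrightarrow> norm x = 1"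

definition product_state :: "complex ^ (2 \<times> 2) \<Rightarrow> bool"
  where "product_state w \<longleftrightarrow> state w \<and> (\<exists>u v. w = u \<otimes> v)"

definition eq_up_to_phase :: "complex ^ 'n::finite \<Rightarrow> complex ^ 'n \<Rightarrow> bool"  (infix "\<simeq>" 50)
  where "x \<simeq> y \<longleftrightarrow> (\<exists>c. cmod c = 1 \<and> x = c *s y)"

end

(* A product state u \<otimes> v orthogonal to |00> has u or v proportional to |1>.  By pigeonhole, two
   of the three remaining states share the factor on which this happens, say the B side; their
   A-factors are then orthogonal and span the qubit space, so orthogonality to these two states
   forces the last B-factor to be |0>, and orthogonality to |00> forces the last A-factor
   to be |1>. *)
theory Submission
  imports Defs
begin

lemma UNIV_bit: "(UNIV :: 2 set) = {0, 1}"
proof -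
  \<comment> \<open>\<open>exhaust_2\<close> lists the elements as 1 and 2; arithmetic in this type
    is modulo 2, so the latter is 0.\<close>
  have "(2::2) = 0" by simp
  with exhaust_2 show ?thesis by auto
qed

lemma vec_bit_eqI:
  fixes x y :: "'a ^ 2"
  assumes "x $ 0 = y $ 0" "x $ 1 = y $ 1"
  shows "x = y"
  unfolding vec_eq_iff
proof
  fix i :: 2
  have "i \<in> {0, 1}" using UNIV_bit by auto
  with assms show "x $ i = y $ i" by auto
qed

lemma braket_self: "braket x x = complex_of_real ((norm x)\<^sup>2)"
proof -
  have "braket x x = (\<Sum>i\<in>UNIV. complex_of_real ((norm (x $ i))\<^sup>2))"
    unfolding braket_def
    by (intro sum.cong refl) (metis complex_norm_square mult.commute)
  also have "\<dots> = complex_of_real ((norm x)\<^sup>2)"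
    by (simp add: norm_vec_def L2_set_def sum_nonneg)
  finally show ?thesis .
qed

lemma braket_commute: "braket y x = cnj (braket x y)"
  by (simp add: braket_def mult.commute)

lemma braket_add_left: "braket (x + y) z = braket x z + braket y z"
  by (simp add: braket_def sum.distrib algebra_simps)

lemma braket_scale_left: "braket (c *s x) z = cnj c * braket x z"
  by (simp add: braket_def sum_distrib_left algebra_simps)

lemma braket_scale_right: "braket x (c *s z) = c * braket x z"
  by (simp add: braket_def sum_distrib_left algebra_simps)

lemma braket_ket: "braket (ket j) x = x $ j"
  by (simp add: braket_def ket_def axis_def if_distrib if_distribR cong: if_cong)

text \<open>A sum over index pairs factors into two sums. Orthogonality of product states thus means
  that the brackets of one pair of factors vanish.\<close>

lemma braket_tensor: "braket (a \<otimes> b) (c \<otimes> d) = braket a c * braket b d"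
  unfolding braket_def tensor_def sum_product UNIV_Times_UNIV[symmetric]
  by (subst sum.cartesian_product) (auto intro!: sum.cong simp: algebra_simps)

lemma norm_scale_vec: "norm (c *s x) = cmod c * norm (x :: complex ^ 'n::finite)"
  by (simp add: norm_vec_def norm_mult L2_set_right_distrib)

text \<open>The diagonal case of \<open>braket_tensor\<close> gives the identity for squares, and
  both sides are nonnegative.\<close>

lemma norm_tensor: "norm (u \<otimes> v) = norm u * norm v"
proof -
  have "complex_of_real ((norm (u \<otimes> v))\<^sup>2) = complex_of_real ((norm u * norm v)\<^sup>2)"
    using braket_tensor[of u v u v] by (simp only: braket_self of_real_mult power_mult_distrib)
  then show ?thesis
    by (metis of_real_eq_iff power2_eq_iff_nonneg norm_ge_zero mult_nonneg_nonneg)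
qed

lemma tensor_scale_left: "(c *s u) \<otimes> v = c *s (u \<otimes> v)"
  by (simp add: tensor_def vec_eq_iff)

lemma tensor_scale_right: "u \<otimes> (c *s v) = c *s (u \<otimes> v)"
  by (simp add: tensor_def vec_eq_iff)

lemma phase_tensor: "u \<simeq> u' \<Longrightarrow> v \<simeq> v' \<Longrightarrow> u \<otimes> v \<simeq> u' \<otimes> v'"
  unfolding eq_up_to_phase_def
  by (metis tensor_scale_left tensor_scale_right vector_smult_assoc norm_mult mult_1)

lemma phase_refl: "x \<simeq> x"
  unfolding eq_up_to_phase_def by (rule exI[of _ 1]) simp

text \<open>The factors in \<open>product_state\<close> need not be unit vectors, but their norms
  are reciprocal, so moving the scalar \<open>norm u\<close> from one factor to the other normalises
  both.\<close>

lemma product_stateE: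
  assumes "product_state w"
  obtains u v where "norm u = 1" "norm v = 1" "w = u \<otimes> v"
proof -
  from assms obtain u v where w: "w = u \<otimes> v" "norm (u \<otimes> v) = 1"
    by (auto simp: product_state_def state_def)
  then have uv: "norm u * norm v = 1" by (simp add: norm_tensor)
  let ?c = "complex_of_real (norm u)"
  from uv have c: "norm u \<noteq> 0" by auto
  then have "w = (inverse ?c *s u) \<otimes> (?c *s v)"
    by (simp add: w tensor_scale_left tensor_scale_right vector_smult_assoc)
  moreover have "norm (inverse ?c *s u) = 1" "norm (?c *s v) = 1"
    using c uv by (simp_all add: norm_scale_vec norm_inverse)
  ultimately show thesis using that by blast
qed

lemma phase_ket:
  assumes "norm u = 1" "\<And>i. i \<noteq> j \<Longrightarrow> u $ i = 0" shows "u \<simeq> ket j"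
proof -
  have u: "u = (u $ j) *s ket j"
    using assms(2) by (auto simp: vec_eq_iff ket_def axis_def)
  have "norm (ket j) = 1" by (simp add: ket_def norm_axis_1)
  with u assms(1) have "cmod (u $ j) = 1" by (metis norm_scale_vec mult.right_neutral)
  with u show ?thesis unfolding eq_up_to_phase_def by blast
qed

lemma phase_ket_1: "norm u = 1 \<Longrightarrow> u $ 0 = 0 \<Longrightarrow> u \<simeq> ket 1"
  by (erule phase_ket) (metis UNIV_bit UNIV_I insertE singletonD)

lemma phase_ket_0: "norm u = 1 \<Longrightarrow> u $ 1 = 0 \<Longrightarrow> u \<simeq> ket 0"
  by (erule phase_ket) (metis UNIV_bit UNIV_I insertE singletonD)

lemma orthonormal_basis_pair:
  fixes a b :: "complex ^ 2"
  assumes "norm a = 1" "norm b = 1" "braket a b = 0"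
  shows "a \<noteq> b" "orthonormal_basis {a, b}"
proof -
  have aa: "braket a a = 1" and bb: "braket b b = 1" using assms by (simp_all add: braket_self)
  then show ab: "a \<noteq> b" using assms by auto
  have ba: "braket b a = 0" using assms braket_commute[of b a] by simp
  have "b \<noteq> 0" using assms by auto
  \<comment> \<open>If \<open>a = k *s b\<close>, then \<open>braket a a\<close> would be
    \<open>k * braket a b\<close>, which is 0 and not 1.\<close>
  moreover have "a \<noteq> k *s b" for k
    using assms aa by (auto simp: braket_scale_right)
  ultimately have ind: "vec.independent {a, b}"
    using ab by (auto simp: vec.independent_insert vec.span_singleton)
  \<comment> \<open>Two independent vectors exhaust a space of dimension 2.\<close>
  have "vec.span {a, b} = UNIV"
    using vec.card_ge_dim_independent[of "{a, b}" UNIV] ind ab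
    by (auto simp: vec.dim_UNIV card_cart_basis)
  with ind assms ba show "orthonormal_basis {a, b}"
    by (auto simp: orthonormal_basis_def pairwise_def)
qed

text \<open>Orthogonality to \<open>u\<close> passes from \<open>S\<close> to its span, hence to
  \<open>u\<close> itself, so \<open>braket u u = 0\<close>.\<close>

lemma orthogonal_basis_imp_zero:
  fixes u :: "complex ^ 'n::finite"
  assumes "orthonormal_basis S" "\<And>a. a \<in> S \<Longrightarrow> braket a u = 0"
  shows "u = 0"
proof -
  have "braket x u = 0" if "x \<in> vec.span S" for x
    using that
  proof (induction rule: vec.span_induct_alt)
    case base
    show ?case by (simp add: braket_def)
  next
    case (step c x y)
    then show ?case by (simp add: braket_add_left braket_scale_left assms(2))
  qed
  then have "braket u u = 0" using assms(1) by (simp add: orthonormal_basis_def)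
  then show ?thesis by (simp add: braket_self)
qed

text \<open>The hypotheses are the orthogonality relations written in factors rather than in tensor
  products. Since the scalar products commute, the lemma applies equally with A and B
  exchanged.\<close>

lemma product_basis_factors:
  fixes u\<^sub>1 u\<^sub>2 u\<^sub>3 v\<^sub>1 v\<^sub>2 v\<^sub>3 :: "complex ^ 2"
  assumes "norm u\<^sub>1 = 1" "norm u\<^sub>2 = 1" "norm u\<^sub>3 = 1" "norm v\<^sub>3 = 1"
    and "v\<^sub>1 \<simeq> ket 1" "v\<^sub>2 \<simeq> ket 1"
    and "braket u\<^sub>1 u\<^sub>2 * braket v\<^sub>1 v\<^sub>2 = 0"
    and "braket u\<^sub>1 u\<^sub>3 * braket v\<^sub>1 v\<^sub>3 = 0"
    and "braket u\<^sub>2 u\<^sub>3 * braket v\<^sub>2 v\<^sub>3 = 0"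
    and "u\<^sub>3 $ 0 * v\<^sub>3 $ 0 = 0"
  shows "u\<^sub>1 \<noteq> u\<^sub>2" "orthonormal_basis {u\<^sub>1, u\<^sub>2}" "u\<^sub>3 \<simeq> ket 1" "v\<^sub>3 \<simeq> ket 0"
proof -
  obtain c d where v: "v\<^sub>1 = c *s ket 1" "v\<^sub>2 = d *s ket 1" and "cmod c = 1" "cmod d = 1"
    using assms(5,6) by (auto simp: eq_up_to_phase_def)
  then have cd: "c \<noteq> 0" "d \<noteq> 0" by auto
  \<comment> \<open>Hence \<open>braket v\<^sub>1 v\<^sub>2\<close> is \<open>cnj c * d\<close>,
    which is nonzero, and the other bracket must vanish.\<close>
  have "ket 1 $ 1 = 1" by (simp add: ket_def axis_def)
  then have "braket u\<^sub>1 u\<^sub>2 = 0"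
    using assms(7) cd by (simp add: v braket_scale_left braket_scale_right braket_ket)
  from orthonormal_basis_pair[OF assms(1,2) this]
  show "u\<^sub>1 \<noteq> u\<^sub>2" and ob: "orthonormal_basis {u\<^sub>1, u\<^sub>2}" .
  have v31: "v\<^sub>3 $ 1 = 0"
  proof (rule ccontr)
    assume "v\<^sub>3 $ 1 \<noteq> 0"
    \<comment> \<open>The cofactors are \<open>cnj c * v\<^sub>3 $ 1\<close> and
      \<open>cnj d * v\<^sub>3 $ 1\<close>, both nonzero here.\<close>
    then have "braket u\<^sub>1 u\<^sub>3 = 0" "braket u\<^sub>2 u\<^sub>3 = 0"
      using assms(8,9) cd by (simp_all add: v braket_scale_left braket_ket)
    then have "u\<^sub>3 = 0" by (intro orthogonal_basis_imp_zero[OF ob]) auto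
    with assms(3) show False by simp
  qed
  with assms(4) show "v\<^sub>3 \<simeq> ket 0" by (intro phase_ket_0)
  have "v\<^sub>3 $ 0 \<noteq> 0"
  proof
    assume "v\<^sub>3 $ 0 = 0"
    with v31 have "v\<^sub>3 = 0" by (intro vec_bit_eqI) auto
    with assms(4) show False by simp
  qed
  with assms(3,10) show "u\<^sub>3 \<simeq> ket 1" by (intro phase_ket_1) auto
qed

theorem theorem14:
  fixes B :: "(complex ^ (2 \<times> 2)) set"
  assumes "orthonormal_basis B"
    and "card B = 4"
    and "\<forall>w\<in>B. product_state w"
    and "ket_AB 0 0 \<in> B"
  shows "\<exists>r\<^sub>1 r\<^sub>2 r\<^sub>3. B - {ket_AB 0 0} = {r\<^sub>1, r\<^sub>2, r\<^sub>3} \<and>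
    ((\<exists>\<alpha>\<^sub>0 \<alpha>\<^sub>1. \<alpha>\<^sub>0 \<noteq> \<alpha>\<^sub>1 \<and> orthonormal_basis {\<alpha>\<^sub>0, \<alpha>\<^sub>1} \<and>
        r\<^sub>1 \<simeq> \<alpha>\<^sub>0 \<otimes> ket 1 \<and> r\<^sub>2 \<simeq> \<alpha>\<^sub>1 \<otimes> ket 1 \<and> r\<^sub>3 \<simeq> ket_AB 1 0) \<or>
     (\<exists>\<beta>\<^sub>0 \<beta>\<^sub>1. \<beta>\<^sub>0 \<noteq> \<beta>\<^sub>1 \<and> orthonormal_basis {\<beta>\<^sub>0, \<beta>\<^sub>1} \<and>
        r\<^sub>1 \<simeq> ket 1 \<otimes> \<beta>\<^sub>0 \<and> r\<^sub>2 \<simeq> ket 1 \<otimes> \<beta>\<^sub>1 \<and> r\<^sub>3 \<simeq> ket_AB 0 1))"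
    (is "\<exists>r\<^sub>1 r\<^sub>2 r\<^sub>3. ?R r\<^sub>1 r\<^sub>2 r\<^sub>3 \<and> (?A r\<^sub>1 r\<^sub>2 r\<^sub>3 \<or> ?B r\<^sub>1 r\<^sub>2 r\<^sub>3)")
proof -
  \<comment> \<open>Normalised A- and B-factors of \<open>w\<close>. They are unique only up to
    phases, so \<open>b w\<close> is chosen to match \<open>a w\<close>; independent choices need
    not multiply to \<open>w\<close>.\<close>
  define a b where "a w = (SOME u. \<exists>v. norm u = 1 \<and> norm v = 1 \<and> w = u \<otimes> v)"
    and "b w = (SOME v. norm (a w) = 1 \<and> norm v = 1 \<and> w = a w \<otimes> v)" for w
  have ab: "norm (a w) = 1" "norm (b w) = 1" "w = a w \<otimes> b w" if "w \<in> B" for w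
  proof -
    have "\<exists>u v. norm u = 1 \<and> norm v = 1 \<and> w = u \<otimes> v"
      using assms(3) that product_stateE by metis
    then have "\<exists>v. norm (a w) = 1 \<and> norm v = 1 \<and> w = a w \<otimes> v"
      unfolding a_def by (rule someI_ex)
    then have "norm (a w) = 1 \<and> norm (b w) = 1 \<and> w = a w \<otimes> b w"
      unfolding b_def by (rule someI_ex)
    then show "norm (a w) = 1" "norm (b w) = 1" "w = a w \<otimes> b w" by auto
  qed
  have orth: "braket (a x) (a y) * braket (b x) (b y) = 0" if "x \<in> B" "y \<in> B" "x \<noteq> y" for x y
    using assms(1) that ab(3)[of x] ab(3)[of y]
    unfolding orthonormal_basis_def pairwise_def by (metis braket_tensor)
  have zero: "a w $ 0 * b w $ 0 = 0" if "w \<in> B" "w \<noteq> ket_AB 0 0" for w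
  proof -
    have "braket (ket_AB 0 0) w = 0"
      using assms(1,4) that unfolding orthonormal_basis_def pairwise_def by metis
    \<comment> \<open>This bracket splits into brackets with \<open>ket 0\<close>, which read off
      the 0-coordinates of the factors.\<close>
    then have "braket (ket 0 \<otimes> ket 0) (a w \<otimes> b w) = 0"
      using ab(3)[OF that(1)] by (simp add: ket_AB_def)
    then show ?thesis by (simp add: braket_tensor braket_ket)
  qed
  \<comment> \<open>The B-factors of \<open>x\<close> and \<open>y\<close> are |1> up to phase: this
    yields the first family, with \<open>a x\<close> and \<open>a y\<close> as the basis of the A
    side.\<close>
  have A: "\<exists>r\<^sub>1 r\<^sub>2 r\<^sub>3. ?R r\<^sub>1 r\<^sub>2 r\<^sub>3 \<and> (?A r\<^sub>1 r\<^sub>2 r\<^sub>3 \<or> ?B r\<^sub>1 r\<^sub>2 r\<^sub>3)"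
    if "B - {ket_AB 0 0} = {x, y, z}" "distinct [x, y, z]" "b x $ 0 = 0" "b y $ 0 = 0" for x y z
  proof -
    have xyz: "x \<in> B" "y \<in> B" "z \<in> B" "z \<noteq> ket_AB 0 0" using that(1) by blast+
    have "b x \<simeq> ket 1" "b y \<simeq> ket 1" using that xyz ab by (auto intro: phase_ket_1)
    note b = this
    have f: "a x \<noteq> a y" "orthonormal_basis {a x, a y}" "a z \<simeq> ket 1" "b z \<simeq> ket 0"
      using product_basis_factors[of "a x" "a y" "a z" "b z" "b x" "b y"]
        ab xyz b orth zero that(2) by auto
    \<comment> \<open>Replacing a factor by the ket it is proportional to costs only a
      phase.\<close>
    have "x \<simeq> a x \<otimes> ket 1" "y \<simeq> a y \<otimes> ket 1" "z \<simeq> ket_AB 1 0"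
      unfolding ket_AB_def using ab(3) xyz f b phase_tensor phase_refl by metis+
    with f that(1) show ?thesis by blast
  qed
  \<comment> \<open>The mirror image, with \<open>b x\<close> and \<open>b y\<close> as the basis of
    the B side.\<close>
  have B: "\<exists>r\<^sub>1 r\<^sub>2 r\<^sub>3. ?R r\<^sub>1 r\<^sub>2 r\<^sub>3 \<and> (?A r\<^sub>1 r\<^sub>2 r\<^sub>3 \<or> ?B r\<^sub>1 r\<^sub>2 r\<^sub>3)"
    if "B - {ket_AB 0 0} = {x, y, z}" "distinct [x, y, z]" "a x $ 0 = 0" "a y $ 0 = 0" for x y z
  proof -
    have xyz: "x \<in> B" "y \<in> B" "z \<in> B" "z \<noteq> ket_AB 0 0" using that(1) by blast+
    have "a x \<simeq> ket 1" "a y \<simeq> ket 1" using that xyz ab by (auto intro: phase_ket_1)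
    note a = this
    have f: "b x \<noteq> b y" "orthonormal_basis {b x, b y}" "b z \<simeq> ket 1" "a z \<simeq> ket 0"
      using product_basis_factors[of "b x" "b y" "b z" "a z" "a x" "a y"]
        ab xyz a orth zero that(2) by (auto simp: mult.commute)
    have "x \<simeq> ket 1 \<otimes> b x" "y \<simeq> ket 1 \<otimes> b y" "z \<simeq> ket_AB 0 1"
      unfolding ket_AB_def using ab(3) xyz f a phase_tensor phase_refl by metis+
    with f that(1) show ?thesis by blast
  qed
  have "card (B - {ket_AB 0 0}) = 3" using assms(2,4) by simp
  then obtain x y z where xyz: "B - {ket_AB 0 0} = {x, y, z}" "distinct [x, y, z]"
    unfolding card_3_iff by auto
  \<comment> \<open>\<open>A\<close> and \<open>B\<close> expect the two states sharing a factor to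
    come first; these orders cover the other two pairs.\<close>
  then have perm: "B - {ket_AB 0 0} = {x, z, y}" "distinct [x, z, y]"
      "B - {ket_AB 0 0} = {y, z, x}" "distinct [y, z, x]"
    by auto
  have "a w $ 0 = 0 \<or> b w $ 0 = 0" if "w \<in> {x, y, z}" for w
    using zero[of w] that xyz(1) by auto
  \<comment> \<open>Pigeonhole: each of three states has a vanishing 0-coordinate on one of two
    sides, so some side serves two of them. The six cases are a side and a pair of states.\<close>
  then consider "b x $ 0 = 0" "b y $ 0 = 0" | "b x $ 0 = 0" "b z $ 0 = 0"
    | "b y $ 0 = 0" "b z $ 0 = 0" | "a x $ 0 = 0" "a y $ 0 = 0"
    | "a x $ 0 = 0" "a z $ 0 = 0" | "a y $ 0 = 0" "a z $ 0 = 0"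
    by blast
  then show ?thesis
  proof cases
    case 1 then show ?thesis by (rule A[OF xyz])
  next
    case 2 then show ?thesis by (rule A[OF perm(1,2)])
  next
    case 3 then show ?thesis by (rule A[OF perm(3,4)])
  next
    case 4 then show ?thesis by (rule B[OF xyz])
  next
    case 5 then show ?thesis by (rule B[OF perm(1,2)])
  next
    case 6 then show ?thesis by (rule B[OF perm(3,4)])
  qed
qed

end
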